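(* Let $\Omega\subset\mathbb{R}$ be a bounded open interval, let $1<p<\infty$, $q=\frac{p}{p-1}$, and let $V_h\subset H_0^1(\Omega)$ be the finite element space of piecewise polynomials of degree at most $r-1$, $r\ge 2$, associated with a partition $\mathcal{T}_h$ of $\Omega$. If $f\in L^2(\Omega)$, then there is a pair $(u_h,v_h)\in V_h\times V_h$ such that $$(\nabla v_h,\nabla\psi_h) = -(f,\psi_h) \quad \forall\,\psi_h\in V_h, \qquad (\nabla u_h,\nabla\eta_h) = -(|v_h|^{q-2}v_h,\eta_h) \quad \forall\,\eta_h\in V_h .$$
   Context: $(\cdot,\cdot)$ denotes the $L^2(\Omega)$ inner product, and $\nabla$ is the (weak) derivative in dimension one. $\mathcal{T}_h$ is a partition of $\Omega$ into finitely many nondegenerate intervals $T_1,\dots,T_n$ with pairwise disjoint interiors, whose parameter $h$ is the mesh size. For an integer $r\ge 2$, $$V_h=\{w\in C(\overline\Omega): w=0 \text{ on } \partial\Omega,\ w|_{T_k} \text{ is a polynomial of degree at most } r-1 \text{ for every } T_k\in\mathcal{T}_h\}.$$ The expression $|v_h|^{q-2}v_h$ is understood to be $0$ where $v_h=0$. *)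

theory Defs
  imports "HOL-Analysis.Analysis" "HOL-Computational_Algebra.Polynomial"
begin

definition L2_fun :: "real set \<Rightarrow> (real \<Rightarrow> real) \<Rightarrow> bool" where
  "L2_fun \<Omega> f \<longleftrightarrow> f \<in> borel_measurable (lebesgue_on \<Omega>) \<and> integrable (lebesgue_on \<Omega>) (\<lambda>x. (f x)\<^sup>2)"

definition L2_inner :: "real set \<Rightarrow> (real \<Rightarrow> real) \<Rightarrow> (real \<Rightarrow> real) \<Rightarrow> real" where
  "L2_inner \<Omega> f g = (LINT x|lebesgue_on \<Omega>. f x * g x)"

definition locally_integrable :: "real set \<Rightarrow> (real \<Rightarrow> real) \<Rightarrow> bool" where
  "locally_integrable \<Omega> w \<longleftrightarrow> (\<forall>K. compact K \<and> K \<subseteq> \<Omega> \<longrightarrow> integrable (lebesgue_on K) w)"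

(* C_c^infinity(Omega), as functions on the whole line (extended by 0) *)
definition test_functions :: "real set \<Rightarrow> (real \<Rightarrow> real) set" where
  "test_functions \<Omega> = {\<phi>. (\<forall>n x. (deriv ^^ n) \<phi> differentiable (at x)) \<and>
     compact (closure {x. \<phi> x \<noteq> 0}) \<and> closure {x. \<phi> x \<noteq> 0} \<subseteq> \<Omega>}"

definition has_weak_deriv :: "real set \<Rightarrow> (real \<Rightarrow> real) \<Rightarrow> (real \<Rightarrow> real) \<Rightarrow> bool" where
  "has_weak_deriv \<Omega> w g \<longleftrightarrow> locally_integrable \<Omega> w \<and> locally_integrable \<Omega> g \<and>
     (\<forall>\<phi>\<in>test_functions \<Omega>.
        (LINT x|lebesgue_on \<Omega>. w x * deriv \<phi> x) = - (LINT x|lebesgue_on \<Omega>. g x * \<phi> x))"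

(* For open Omega a weak derivative is determined up to a null set, so integrals over Omega
   do not depend on the representative chosen here. *)
definition weak_deriv :: "real set \<Rightarrow> (real \<Rightarrow> real) \<Rightarrow> real \<Rightarrow> real" where
  "weak_deriv \<Omega> w = (SOME g. has_weak_deriv \<Omega> w g)"

(* The cells are the closed intervals; division_of provides finiteness, pairwise disjoint
   interiors and union closure Omega, but admits one-point cells. *)
definition interval_partition :: "real set \<Rightarrow> real set set \<Rightarrow> bool" where
  "interval_partition \<Omega> \<T> \<longleftrightarrow> \<T> division_of (closure \<Omega>) \<and> (\<forall>K\<in>\<T>. interior K \<noteq> {})"

(* Only the values on closure Omega matter; values elsewhere are left unconstrained. *)
definition fe_space :: "real set \<Rightarrow> real set set \<Rightarrow> nat \<Rightarrow> (real \<Rightarrow> real) set" where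
  "fe_space \<Omega> \<T> r = {w. continuous_on (closure \<Omega>) w \<and> (\<forall>x\<in>frontier \<Omega>. w x = 0) \<and>
     (\<forall>K\<in>\<T>. \<exists>P :: real poly. degree P \<le> r - 1 \<and> (\<forall>x\<in>K. w x = poly P x))}"

end

theory Submission imports Defs begin

text \<open>The system is triangular: the first equation determines \<open>v\<close>, and the second is then a discrete
  Poisson problem for \<open>u\<close> whose right-hand side is a known continuous function. So everything rests
  on the solvability of one discrete Poisson problem \<open>(v', \<psi>') = - (f, \<psi>)\<close> for integrable \<open>f\<close>, which is
  \<open>ex_discrete_Poisson_solution\<close>.

  In dimension one this problem splits into local ones. The map \<open>v \<mapsto> v'\<close> identifies the finite element
  space, up to values outside \<open>{a..b}\<close>, with the piecewise polynomials of degree at most \<open>r - 2\<close> and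
  mean zero (\<open>ex_fe_function_with_deriv\<close>), and a test function is recovered from the pieces of its derivative
  by integration (\<open>fe_function_eq_sum_cell_ramps\<close>). Hence \<open>- (f, \<psi>)\<close> is a sum of linear functionals
  of the polynomials \<open>\<psi>'\<close> on the single cells, and each of these is represented in \<open>L\<^sup>2\<close> of its cell by a
  polynomial of degree at most \<open>r - 2\<close> (\<open>ex_poly_representing_functional\<close>). Together the representatives
  form a piecewise polynomial; after subtraction of its mean, which the derivatives of test functions
  do not see, it is \<open>v'\<close>. No basis of the finite element space is involved.

  What remains is to identify the weak derivative of a finite element function with its piecewise
  derivative (\<open>weak_deriv_eq_classical\<close>). That the piecewise derivative is a weak derivative is
  integration by parts. Uniqueness is the fundamental lemma of the calculus of variations, which is
  proved by testing with smooth bumps that converge to indicators of intervals, followed by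
  Lebesgue differentiation.\<close>

section \<open>Smooth bump functions\<close>

text \<open>The classical flat functions: \<open>exp (- 1 / x)\<close> on the positive half line and \<open>0\<close> elsewhere,
  with a polynomial in \<open>1 / x\<close> as a factor because that is the form which all derivatives take.\<close>
definition flat_exp :: "real poly \<Rightarrow> real \<Rightarrow> real" where
  "flat_exp p x = (if x > 0 then poly p (1 / x) * exp (- 1 / x) else 0)"

lemma poly_times_exp_neg_tendsto_0:
  "((\<lambda>y::real. poly p y * exp (- y)) \<longlongrightarrow> 0) at_top"
proof -
  have "((\<lambda>y::real. \<Sum>i\<le>degree p. coeff p i * (y ^ i / exp y)) \<longlongrightarrow> (\<Sum>i\<le>degree p. coeff p i * 0)) at_top"
    by (intro tendsto_intros tendsto_power_div_exp_0)
  moreover have "(\<Sum>i\<le>degree p. coeff p i * (y ^ i / exp y)) = poly p y * exp (- y)" for y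
    by (simp add: poly_altdef exp_minus sum_distrib_right divide_inverse mult.assoc)
  ultimately show ?thesis by simp
qed

lemma flat_exp_tendsto_0: "(flat_exp p \<longlongrightarrow> 0) (at 0)"
proof (rule filterlim_split_at)
  have "eventually (\<lambda>x. 0 = flat_exp p x) (at_left 0)"
    unfolding eventually_at_filter by (simp add: flat_exp_def)
  then show "(flat_exp p \<longlongrightarrow> 0) (at_left 0)"
    by (rule Lim_transform_eventually[OF tendsto_const])
  have "((\<lambda>x. poly p (inverse x) * exp (- inverse x)) \<longlongrightarrow> 0) (at_right 0)"
    by (rule filterlim_compose[OF poly_times_exp_neg_tendsto_0 filterlim_inverse_at_top_right])
  moreover have "eventually (\<lambda>x. poly p (inverse x) * exp (- inverse x) = flat_exp p x) (at_right 0)"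
    unfolding eventually_at_filter by (simp add: flat_exp_def divide_inverse)
  ultimately show "(flat_exp p \<longlongrightarrow> 0) (at_right 0)"
    by (rule Lim_transform_eventually)
qed

text \<open>In the variable \<open>y = 1 / x\<close> the operator \<open>d/dx\<close> is \<open>- y\<^sup>2 d/dy\<close>, which turns \<open>p y * exp (- y)\<close> into
  \<open>y\<^sup>2 * (p y - p' y) * exp (- y)\<close>.\<close>
lemma flat_exp_has_derivative:
  "(flat_exp p has_real_derivative flat_exp ([:0, 0, 1:] * (p - pderiv p)) x) (at x)"
proof -
  consider "x > 0" | "x < 0" | "x = 0" by linarith
  then show ?thesis
  proof cases
    case 1
    have "((\<lambda>x. poly p (1 / x) * exp (- 1 / x)) has_real_derivative
        flat_exp ([:0, 0, 1:] * (p - pderiv p)) x) (at x)"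
      using 1 by (auto intro!: derivative_eq_intros
          simp: flat_exp_def algebra_simps power2_eq_square divide_simps)
    then show ?thesis
      by (rule has_field_derivative_transform_within_open[where S = "{0<..}"])
        (use 1 in \<open>auto simp: flat_exp_def\<close>)
  next
    case 2
    have "((\<lambda>x. 0) has_real_derivative flat_exp ([:0, 0, 1:] * (p - pderiv p)) x) (at x)"
      using 2 by (auto simp: flat_exp_def)
    then show ?thesis
      by (rule has_field_derivative_transform_within_open[where S = "{..<0}"])
        (use 2 in \<open>auto simp: flat_exp_def\<close>)
  next
    case 3
    \<comment> \<open>The difference quotient at 0 is again a function of this family.\<close>
    have "(flat_exp p (0 + h) - flat_exp p 0) / h = flat_exp (pCons 0 p) h" if "h \<noteq> 0" for h
      using that by (auto simp: flat_exp_def)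
    then have "((\<lambda>h. (flat_exp p (0 + h) - flat_exp p 0) / h) \<longlongrightarrow> 0) (at 0)"
      using flat_exp_tendsto_0[of "pCons 0 p"]
      by (simp add: eventually_at_filter cong: Lim_cong_within)
    then have "(flat_exp p has_real_derivative 0) (at 0)"
      by (simp only: DERIV_def)
    moreover have "flat_exp q 0 = 0" for q
      by (simp add: flat_exp_def)
    ultimately show ?thesis
      using 3 by (simp only:)
  qed
qed

text \<open>Smoothness of a product of flat functions would need a Leibniz rule for iterated derivatives.
  It is simpler to exhibit a set of differentiable functions that contains the product and is
  closed under differentiation: the algebra generated by the flat functions composed with affine
  maps.\<close>
inductive_set flat_algebra :: "(real \<Rightarrow> real) set" where
  base: "(\<lambda>x. flat_exp p (m * x + c)) \<in> flat_algebra"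
| add: "f \<in> flat_algebra \<Longrightarrow> g \<in> flat_algebra \<Longrightarrow> (\<lambda>x. f x + g x) \<in> flat_algebra"
| mult: "f \<in> flat_algebra \<Longrightarrow> g \<in> flat_algebra \<Longrightarrow> (\<lambda>x. f x * g x) \<in> flat_algebra"

lemma flat_algebra_closed_deriv:
  assumes "f \<in> flat_algebra"
  shows "\<exists>f'\<in>flat_algebra. \<forall>x. (f has_real_derivative f' x) (at x)"
  using assms
proof induction
  case (base p m c)
  let ?q = "[:0, 0, 1:] * (p - pderiv p)"
  have "((\<lambda>x. flat_exp p (m * x + c)) has_real_derivative flat_exp ?q (m * x + c) * m) (at x)" for x
    by (rule DERIV_chain2[OF flat_exp_has_derivative]) (auto intro!: derivative_eq_intros)
  moreover have "flat_exp ?q y * m = flat_exp (smult m ?q) y" for y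
    by (simp add: flat_exp_def)
  ultimately show ?case
    by (intro bexI[OF _ flat_algebra.base[of "smult m ?q" m c]]) auto
next
  case (add f g)
  then obtain f' g' where "f' \<in> flat_algebra" "g' \<in> flat_algebra"
    "\<forall>x. (f has_real_derivative f' x) (at x)" "\<forall>x. (g has_real_derivative g' x) (at x)"
    by blast
  then show ?case
    by (intro bexI[where x = "\<lambda>x. f' x + g' x"]) (auto intro: flat_algebra.add DERIV_add)
next
  case (mult f g)
  then obtain f' g' where *: "f' \<in> flat_algebra" "g' \<in> flat_algebra"
    "\<forall>x. (f has_real_derivative f' x) (at x)" "\<forall>x. (g has_real_derivative g' x) (at x)"
    by blast
  have "(\<lambda>x. f' x * g x + g' x * f x) \<in> flat_algebra"
    using mult * by (intro flat_algebra.add flat_algebra.mult)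
  with * show ?case
    by (intro bexI[where x = "\<lambda>x. f' x * g x + g' x * f x"]) (auto intro: DERIV_mult)
qed

lemma flat_algebra_smooth:
  assumes "f \<in> flat_algebra"
  shows "(deriv ^^ n) f differentiable (at x)"
proof -
  have "(deriv ^^ n) f \<in> flat_algebra"
  proof (induction n)
    case (Suc n)
    obtain f' where "f' \<in> flat_algebra" "\<forall>x. ((deriv ^^ n) f has_real_derivative f' x) (at x)"
      using flat_algebra_closed_deriv[OF Suc] by blast
    moreover from this have "deriv ((deriv ^^ n) f) = f'"
      by (intro ext DERIV_imp_deriv) auto
    ultimately show ?case by simp
  qed (use assms in simp)
  then show ?thesis
    using flat_algebra_closed_deriv real_differentiable_def by blast
qed

text \<open>For \<open>k = 1\<close> and \<open>c < d\<close> this is the usual bump with support \<open>{c..d}\<close>; the parameter \<open>k\<close> takes its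
  \<open>k\<close>-th root, since \<open>exp (- 1 / (k * y)) = exp (- 1 / y) powr (1 / k)\<close>. Roots of a number strictly
  between 0 and 1 tend to 1, so the bumps tend to the indicator of \<open>{c<..<d}\<close>.\<close>
definition bump :: "real \<Rightarrow> real \<Rightarrow> real \<Rightarrow> real \<Rightarrow> real" where
  "bump k c d x = flat_exp 1 (k * (x - c)) * flat_exp 1 (k * (d - x))"

lemma flat_exp_1_bounds: "0 \<le> flat_exp 1 x" "flat_exp 1 x \<le> 1"
  by (auto simp: flat_exp_def)

lemma bump_bounds: "0 \<le> bump k c d x" "bump k c d x \<le> 1"
  unfolding bump_def using flat_exp_1_bounds by (auto intro: mult_le_one)

lemma bump_eq_0: "bump k c d x = 0" if "k > 0" "x \<notin> {c<..<d}"
  using that by (auto simp: bump_def flat_exp_def zero_less_mult_iff)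

lemma bump_tendsto_indicator:
  "(\<lambda>k. bump (real (Suc k)) c d x) \<longlonglongrightarrow> indicator {c<..<d} x"
proof (cases "x \<in> {c<..<d}")
  case True
  have lim: "(\<lambda>k. flat_exp 1 (real (Suc k) * y)) \<longlonglongrightarrow> 1" if "y > 0" for y
  proof -
    have "(\<lambda>k. exp (- (inverse (real (Suc k)) * (1 / y)))) \<longlonglongrightarrow> exp (- (0 * (1 / y)))"
      by (intro tendsto_intros LIMSEQ_inverse_real_of_nat)
    moreover have "flat_exp 1 (real (Suc k) * y) = exp (- (inverse (real (Suc k)) * (1 / y)))" for k
      using that by (simp add: flat_exp_def divide_simps del: of_nat_Suc)
    ultimately show ?thesis by simp
  qed
  have "(\<lambda>k. bump (real (Suc k)) c d x) \<longlonglongrightarrow> 1 * 1"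
    unfolding bump_def by (intro tendsto_mult lim) (use True in auto)
  with True show ?thesis by simp
qed (simp add: bump_eq_0)

lemma bump_test_function:
  assumes "k > 0" "a < c" "d < b"
  shows "bump k c d \<in> test_functions {a<..<b}"
proof -
  have "(\<lambda>x. flat_exp 1 (k * x + (- k * c)) * flat_exp 1 ((- k) * x + k * d)) \<in> flat_algebra"
    by (intro flat_algebra.mult flat_algebra.base)
  also have "(\<lambda>x. flat_exp 1 (k * x + (- k * c)) * flat_exp 1 ((- k) * x + k * d)) = bump k c d"
    by (auto simp: bump_def algebra_simps)
  finally have "(deriv ^^ n) (bump k c d) differentiable (at x)" for n x
    by (rule flat_algebra_smooth)
  moreover have sub: "closure {x. bump k c d x \<noteq> 0} \<subseteq> {c..d}"
  proof (rule closure_minimal)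
    show "{x. bump k c d x \<noteq> 0} \<subseteq> {c..d}"
      using bump_eq_0[OF assms(1)] by (auto simp: not_le dest: less_imp_le) (meson greaterThanLessThan_iff not_le order.strict_iff_order)+
  qed simp
  moreover have "compact (closure {x. bump k c d x \<noteq> 0})"
    using sub by (metis closed_closure compact_Icc compact_Int_closed inf.absorb_iff2)
  moreover have "{c..d} \<subseteq> {a<..<b}" using assms by auto
  ultimately show ?thesis
    unfolding test_functions_def by blast
qed

section \<open>Weak derivatives on an interval\<close>

lemma integrable_lebesgue_on_subset:
  fixes f :: "real \<Rightarrow> real"
  assumes "integrable (lebesgue_on T) f" "S \<subseteq> T" "S \<in> sets lebesgue" "T \<in> sets lebesgue"
  shows "integrable (lebesgue_on S) f"
proof -
  have "set_integrable lebesgue T f"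
    using assms by (simp add: set_integrable_def integrable_restrict_space)
  then have "set_integrable lebesgue S f"
    by (rule set_integrable_subset) (use assms in auto)
  then show ?thesis
    using assms by (simp add: set_integrable_def integrable_restrict_space)
qed

lemma locally_integrable_Icc:
  assumes "locally_integrable {a<..<b} g" "a < c" "d < b"
  shows "integrable (lebesgue_on {c..d}) g"
proof -
  have "compact {c..d}" "{c..d} \<subseteq> {a<..<b}" using assms by auto
  with assms(1) show ?thesis unfolding locally_integrable_def by blast
qed

text \<open>A weak derivative is only tested against smooth functions; in the limit these tests determine
  its integral over every compact subinterval. The bumps are dominated by the indicator of
  \<open>{c..d}\<close>, on which \<open>g\<close> is integrable.\<close>
lemma integral_bump_tendsto:
  fixes g :: "real \<Rightarrow> real"
  assumes g: "locally_integrable {a<..<b} g" and cd: "a < c" "d < b"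
  shows "(\<lambda>k. LINT x|lebesgue_on {a<..<b}. g x * bump (real (Suc k)) c d x) \<longlonglongrightarrow> integral {c..d} g"
proof -
  have int: "integrable (lebesgue_on {c..d}) g"
    by (rule locally_integrable_Icc[OF g cd])
  then have intI: "integrable lebesgue (\<lambda>x. indicator {c..d} x * g x)"
    by (simp add: integrable_restrict_space)
  have "(LINT x|lebesgue_on {a<..<b}. g x * bump (real (Suc k)) c d x)
      = (LINT x|lebesgue. (indicator {c..d} x * g x) * bump (real (Suc k)) c d x)" for k
    using cd bump_eq_0[of "real (Suc k)" _ c d]
    by (subst integral_restrict_space) (auto intro!: Bochner_Integration.integral_cong simp: indicator_def)
  moreover have "(\<lambda>k. LINT x|lebesgue. (indicator {c..d} x * g x) * bump (real (Suc k)) c d x)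
      \<longlonglongrightarrow> (LINT x|lebesgue. indicator {c<..<d} x * g x)"
  proof (rule integral_dominated_convergence)
    show "integrable lebesgue (\<lambda>x. \<bar>indicator {c..d} x * g x\<bar>)"
      using intI by (rule integrable_abs)
    have meas: "bump k c d \<in> borel_measurable lebesgue" for k
    proof -
      have "continuous_on UNIV (flat_exp p)" for p
        using flat_exp_has_derivative DERIV_isCont by (blast intro: continuous_at_imp_continuous_on)
      then have comp: "continuous_on UNIV (\<lambda>x. flat_exp p (h x))" if "continuous_on UNIV h" for p h
        using that continuous_on_compose2 by blast
      have "continuous_on UNIV (bump k c d)"
        unfolding bump_def[abs_def] by (intro continuous_on_mult comp) (intro continuous_intros)+
      then have "bump k c d \<in> borel_measurable borel"
        by (rule borel_measurable_continuous_onI)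
      then show ?thesis by (intro measurable_completion) simp
    qed
    show "(\<lambda>x. indicator {c..d} x * g x * bump (real (Suc k)) c d x) \<in> borel_measurable lebesgue" for k
      by (rule borel_measurable_times[OF borel_measurable_integrable[OF intI] meas])
    have "integrable (lebesgue_on {c<..<d}) g"
      by (rule integrable_lebesgue_on_subset[OF int]) auto
    then show "(\<lambda>x. indicator {c<..<d} x * g x) \<in> borel_measurable lebesgue"
      by (auto simp: integrable_restrict_space dest: borel_measurable_integrable)
    show "AE x in lebesgue. (\<lambda>k. indicator {c..d} x * g x * bump (real (Suc k)) c d x)
        \<longlonglongrightarrow> indicator {c<..<d} x * g x"
    proof (rule AE_I2)
      fix x
      have "(\<lambda>k. indicator {c..d} x * g x * bump (real (Suc k)) c d x)
          \<longlonglongrightarrow> indicator {c..d} x * g x * indicator {c<..<d} x"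
        by (intro tendsto_mult_left bump_tendsto_indicator)
      also have "indicator {c..d} x * g x * indicator {c<..<d} x = indicator {c<..<d} x * g x"
        by (auto simp: indicator_def)
      finally show "(\<lambda>k. indicator {c..d} x * g x * bump (real (Suc k)) c d x)
        \<longlonglongrightarrow> indicator {c<..<d} x * g x" .
    qed
    show "AE x in lebesgue. norm (indicator {c..d} x * g x * bump (real (Suc k)) c d x)
        \<le> \<bar>indicator {c..d} x * g x\<bar>" for k
      using bump_bounds[of "real (Suc k)" c d]
      by (intro AE_I2) (auto simp: abs_mult intro!: mult_left_le)
  qed
  moreover have "(LINT x|lebesgue. indicator {c<..<d} x * g x) = integral {c..d} g"
  proof -
    have "(LINT x|lebesgue. indicator {c<..<d} x * g x) = (LINT x|lebesgue_on {c<..<d}. g x)"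
      by (simp add: integral_restrict_space)
    also have "\<dots> = integral {c<..<d} g"
      by (rule lebesgue_integral_eq_integral)
        (auto intro: integrable_lebesgue_on_subset[OF int])
    finally show ?thesis by (simp add: integral_open_interval_real)
  qed
  ultimately show ?thesis by simp
qed

text \<open>By Lebesgue differentiation, \<open>h\<close> is almost everywhere a limit of its averages over intervals
  \<open>{x..x + \<delta>}\<close>, all of which vanish once \<open>h\<close> is extended by 0 outside \<open>{c..d}\<close>.\<close>
lemma negligible_if_interval_integrals_0:
  fixes h :: "real \<Rightarrow> real"
  assumes "h integrable_on {c..d}"
    and zero: "\<And>x y. c \<le> x \<Longrightarrow> y \<le> d \<Longrightarrow> integral {x..y} h = 0"
  shows "negligible {x \<in> {c..d}. h x \<noteq> 0}"
proof -
  let ?h = "\<lambda>x. if x \<in> {c..d} then h x else 0"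
  have int: "integral (cbox x y) ?h = 0" and "?h integrable_on cbox x y" for x y
  proof -
    have *: "{c..d} \<inter> cbox x y = {max x c..min y d}" by auto
    show "integral (cbox x y) ?h = 0"
      unfolding integral_restrict_Int * by (rule zero) auto
    have "h integrable_on {max x c..min y d}"
      by (rule integrable_on_subinterval[OF assms(1)]) auto
    then show "?h integrable_on cbox x y"
      by (simp only: integrable_restrict_Int *)
  qed
  from integrable_ccontinuous_explicit[OF this(2)] obtain N where N: "negligible N"
    and lim: "\<And>x e. x \<notin> N \<Longrightarrow> 0 < e \<Longrightarrow> \<exists>d>0. \<forall>h. 0 < h \<and> h < d \<longrightarrow>
        norm (integral (cbox x (x + h *\<^sub>R One)) ?h /\<^sub>R h ^ DIM(real) - ?h x) < e"
    by blast
  have "?h x = 0" if x: "x \<notin> N" for x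
  proof (rule ccontr)
    assume "?h x \<noteq> 0"
    then obtain e where "e > 0" "\<forall>h. 0 < h \<and> h < e \<longrightarrow>
        norm (integral (cbox x (x + h *\<^sub>R One)) ?h /\<^sub>R h ^ DIM(real) - ?h x) < \<bar>?h x\<bar>"
      using lim[OF x, of "\<bar>?h x\<bar>"] by auto
    from this(2)[rule_format, of "e / 2"] show False
      using \<open>e > 0\<close> unfolding int by simp
  qed
  then have "{x \<in> {c..d}. h x \<noteq> 0} \<subseteq> N" by fastforce
  with N show ?thesis by (rule negligible_subset)
qed

text \<open>Two weak derivatives have the same integral over every compact subinterval, hence agree almost
  everywhere on it; countably many such subintervals exhaust \<open>{a<..<b}\<close>.\<close>
lemma has_weak_deriv_unique:
  assumes g1: "has_weak_deriv {a<..<b} w g1" and g2: "has_weak_deriv {a<..<b} w g2"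
  shows "negligible {x \<in> {a<..<b}. g1 x \<noteq> g2 x}"
proof -
  have loc: "locally_integrable {a<..<b} g1" "locally_integrable {a<..<b} g2"
    using g1 g2 by (auto simp: has_weak_deriv_def)
  have int: "g1 integrable_on {c..d}" "g2 integrable_on {c..d}" if "a < c" "d < b" for c d
    using loc that by (auto intro!: integrable_on_lebesgue_on locally_integrable_Icc)
  have eq: "integral {c..d} g1 = integral {c..d} g2" if "a < c" "d < b" for c d
  proof -
    have "(LINT x|lebesgue_on {a<..<b}. g1 x * bump (real (Suc k)) c d x)
        = (LINT x|lebesgue_on {a<..<b}. g2 x * bump (real (Suc k)) c d x)" for k
      using g1 g2 bump_test_function[of "real (Suc k)" a c d b] that
      unfolding has_weak_deriv_def by fastforce
    then show ?thesis
      using integral_bump_tendsto[OF loc(1) that] integral_bump_tendsto[OF loc(2) that]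
      by (simp add: LIMSEQ_unique)
  qed
  have "negligible {x \<in> {a + inverse (Suc n)..b - inverse (Suc n)}. g1 x - g2 x \<noteq> 0}" for n
  proof (rule negligible_if_interval_integrals_0)
    have "inverse (real (Suc n)) > 0" by simp
    then show "(\<lambda>x. g1 x - g2 x) integrable_on {a + inverse (Suc n)..b - inverse (Suc n)}"
      by (intro integrable_diff int) linarith+
    fix x y assume "a + inverse (real (Suc n)) \<le> x" "y \<le> b - inverse (real (Suc n))"
    then have "a < x" "y < b"
      using \<open>inverse (real (Suc n)) > 0\<close> by linarith+
    then show "integral {x..y} (\<lambda>x. g1 x - g2 x) = 0"
      using eq[of x y] int[of x y] by (simp add: integral_diff)
  qed
  then have "negligible (\<Union>n. {x \<in> {a + inverse (Suc n)..b - inverse (Suc n)}. g1 x - g2 x \<noteq> 0})"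
    by (rule negligible_Union_nat)
  moreover have "{x \<in> {a<..<b}. g1 x \<noteq> g2 x}
      \<subseteq> (\<Union>n. {x \<in> {a + inverse (Suc n)..b - inverse (Suc n)}. g1 x - g2 x \<noteq> 0})"
  proof
    fix x assume x: "x \<in> {x \<in> {a<..<b}. g1 x \<noteq> g2 x}"
    then obtain n where "inverse (real (Suc n)) < min (x - a) (b - x)"
      using reals_Archimedean[of "min (x - a) (b - x)"] by auto
    with x show "x \<in> (\<Union>n. {x \<in> {a + inverse (Suc n)..b - inverse (Suc n)}. g1 x - g2 x \<noteq> 0})"
      by (auto intro!: exI[of _ n])
  qed
  ultimately show ?thesis by (rule negligible_subset)
qed

text \<open>Integration by parts: \<open>w * \<phi>\<close> is continuous and vanishes at both end points, and the fundamental
  theorem of calculus tolerates finitely many points without a derivative.\<close>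
lemma has_weak_deriv_classical:
  fixes w g :: "real \<Rightarrow> real"
  assumes ab: "a \<le> b" and S: "finite S" and w: "continuous_on {a..b} w"
    and g: "integrable (lebesgue_on {a..b}) g"
    and deriv: "\<And>x. x \<in> {a<..<b} - S \<Longrightarrow> (w has_real_derivative g x) (at x)"
  shows "has_weak_deriv {a<..<b} w g"
  unfolding has_weak_deriv_def
proof (intro conjI ballI)
  have loc: "locally_integrable {a<..<b} f" if "integrable (lebesgue_on {a..b}) f" for f :: "real \<Rightarrow> real"
    unfolding locally_integrable_def
  proof safe
    fix K :: "real set" assume "compact K" "K \<subseteq> {a<..<b}"
    then show "integrable (lebesgue_on K) f"
      by (intro integrable_lebesgue_on_subset[OF that])
        (auto simp: compact_imp_closed borel_closed)
  qed
  show "locally_integrable {a<..<b} w" "locally_integrable {a<..<b} g"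
    by (auto intro!: loc continuous_imp_integrable_real w g)
  fix \<phi> assume \<phi>: "\<phi> \<in> test_functions {a<..<b}"
  have diff: "(deriv ^^ n) \<phi> differentiable (at x)" for n x
    using \<phi> by (auto simp: test_functions_def)
  have \<phi>': "(\<phi> has_real_derivative deriv \<phi> x) (at x)" for x
    using diff[of 0 x] by (simp add: DERIV_deriv_iff_real_differentiable)
  have cont: "continuous_on A \<phi>" "continuous_on A (deriv \<phi>)" for A
    using diff[of 0] diff[of 1]
    by (auto intro!: continuous_at_imp_continuous_on differentiable_imp_continuous_within)
  have supp: "\<phi> x = 0" if "x \<notin> {a<..<b}" for x
  proof (rule ccontr)
    assume "\<phi> x \<noteq> 0"
    then have "x \<in> closure {x. \<phi> x \<noteq> 0}" using closure_subset by fastforce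
    with \<phi> that show False by (auto simp: test_functions_def)
  qed
  have "((\<lambda>x. w x * deriv \<phi> x + g x * \<phi> x) has_integral (w b * \<phi> b - w a * \<phi> a)) {a..b}"
  proof (rule fundamental_theorem_of_calculus_interior_strong[OF S ab])
    fix x assume "x \<in> {a<..<b} - S"
    then show "((\<lambda>x. w x * \<phi> x) has_vector_derivative (w x * deriv \<phi> x + g x * \<phi> x)) (at x)"
      using DERIV_mult[OF deriv \<phi>', of x]
      by (simp add: has_real_derivative_iff_has_vector_derivative algebra_simps)
  qed (intro continuous_intros w cont)
  then have sum0: "integral {a..b} (\<lambda>x. w x * deriv \<phi> x + g x * \<phi> x) = 0"
    using supp by (simp add: integral_unique)
  have i1: "integrable (lebesgue_on {a..b}) (\<lambda>x. w x * deriv \<phi> x)"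
    by (intro continuous_imp_integrable_real continuous_intros w cont)
  have "(\<lambda>x. \<phi> x * g x) absolutely_integrable_on {a..b}"
  proof (rule absolutely_integrable_bounded_measurable_product_real)
    show "\<phi> \<in> borel_measurable (lebesgue_on {a..b})"
      by (intro continuous_imp_measurable_on_sets_lebesgue cont) auto
    show "bounded (\<phi> ` {a..b})"
      by (intro compact_imp_bounded compact_continuous_image cont) auto
    show "g absolutely_integrable_on {a..b}"
      using g by (simp add: absolutely_integrable_on_def set_integrable_def integrable_restrict_space)
  qed auto
  then have i2: "integrable (lebesgue_on {a..b}) (\<lambda>x. g x * \<phi> x)"
    by (simp add: set_integrable_def integrable_restrict_space mult.commute)
  have Ioo: "(LINT x|lebesgue_on {a<..<b}. f x) = integral {a..b} f"
    if "integrable (lebesgue_on {a..b}) f" for f :: "real \<Rightarrow> real"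
  proof -
    have "(LINT x|lebesgue_on {a<..<b}. f x) = integral {a<..<b} f"
      by (intro lebesgue_integral_eq_integral integrable_lebesgue_on_subset[OF that]) auto
    then show ?thesis by (simp add: integral_open_interval_real)
  qed
  show "(LINT x|lebesgue_on {a<..<b}. w x * deriv \<phi> x) = - (LINT x|lebesgue_on {a<..<b}. g x * \<phi> x)"
    using sum0 integral_add[OF i1[THEN integrable_on_lebesgue_on] i2[THEN integrable_on_lebesgue_on]]
    by (simp add: Ioo[OF i1] Ioo[OF i2])
qed

text \<open>The weak derivative is chosen arbitrarily among all candidates; existence and uniqueness together
  pin the choice down almost everywhere, which is all that an integral can see.\<close>
lemma weak_deriv_eq_classical:
  fixes w g :: "real \<Rightarrow> real"
  assumes "a \<le> b" "finite S" "continuous_on {a..b} w" "integrable (lebesgue_on {a..b}) g"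
    and "\<And>x. x \<in> {a<..<b} - S \<Longrightarrow> (w has_real_derivative g x) (at x)"
  shows "negligible {x \<in> {a<..<b}. weak_deriv {a<..<b} w x \<noteq> g x}"
proof -
  have *: "has_weak_deriv {a<..<b} w g"
    using assms by (rule has_weak_deriv_classical)
  then have "has_weak_deriv {a<..<b} w (weak_deriv {a<..<b} w)"
    unfolding weak_deriv_def by (rule someI[of "has_weak_deriv {a<..<b} w"])
  from this * show ?thesis by (rule has_weak_deriv_unique)
qed

lemma L2_inner_Ioo_cong_negligible:
  fixes f g f' g' :: "real \<Rightarrow> real"
  assumes f: "negligible {x \<in> {a<..<b}. f' x \<noteq> f x}" and g: "negligible {x \<in> {a<..<b}. g' x \<noteq> g x}"
    and int: "integrable (lebesgue_on {a..b}) (\<lambda>x. f x * g x)"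
  shows "L2_inner {a<..<b} f' g' = integral {a..b} (\<lambda>x. f x * g x)"
proof -
  let ?N = "{x \<in> {a<..<b}. f' x \<noteq> f x} \<union> {x \<in> {a<..<b}. g' x \<noteq> g x}"
  have N: "?N \<in> null_sets lebesgue"
    using f g by (simp only: negligible_iff_null_sets[symmetric] negligible_Un)
  have "integrable (lebesgue_on {a<..<b}) (\<lambda>x. f x * g x)"
    by (rule integrable_lebesgue_on_subset[OF int]) auto
  then have "set_integrable lebesgue {a<..<b} (\<lambda>x. f x * g x)"
    by (simp add: set_integrable_def integrable_restrict_space)
  then have int': "set_integrable lebesgue {a<..<b} (\<lambda>x. f' x * g' x)"
    by (rule absolutely_integrable_spike[where S = ?N]) (use N in \<open>auto simp: negligible_iff_null_sets\<close>)
  then have "L2_inner {a<..<b} f' g' = integral {a<..<b} (\<lambda>x. f' x * g' x)"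
    unfolding L2_inner_def
    by (intro lebesgue_integral_eq_integral) (auto simp: set_integrable_def integrable_restrict_space)
  also have "\<dots> = integral {a<..<b} (\<lambda>x. f x * g x)"
    by (rule integral_spike[where S = ?N]) (use N in \<open>auto simp: negligible_iff_null_sets\<close>)
  finally show ?thesis by (simp add: integral_open_interval_real)
qed

section \<open>Polynomials on an interval\<close>

lemma ex_poly_antiderivative:
  fixes p :: "real poly"
  shows "\<exists>P. pderiv P = p \<and> degree P \<le> Suc (degree p)"
proof -
  let ?P = "\<Sum>i\<le>degree p. monom (coeff p i / real (Suc i)) (Suc i)"
  have "pderiv ?P = (\<Sum>i\<le>degree p. monom (coeff p i) i)"
    using higher_pderiv_sum[of 1 "\<lambda>i. monom (coeff p i / real (Suc i)) (Suc i)" "{..degree p}"]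
    by (simp add: pderiv_monom del: of_nat_Suc)
  then have "pderiv ?P = p" by (simp add: poly_as_sum_of_monoms)
  moreover have "degree ?P \<le> Suc (degree p)"
    by (intro degree_sum_le) (auto intro: order_trans[OF degree_monom_le])
  ultimately show ?thesis by blast
qed

lemma integral_poly_square_pos:
  fixes p :: "real poly"
  assumes "c < d" "p \<noteq> 0"
  shows "integral {c..d} (\<lambda>x. poly p x * poly p x) > 0"
proof -
  have "integral {c..d} (\<lambda>x. poly p x * poly p x) \<noteq> 0"
  proof
    assume "integral {c..d} (\<lambda>x. poly p x * poly p x) = 0"
    then have "\<forall>x\<in>{c..d}. poly p x * poly p x = 0"
      using assms by (subst (asm) integral_eq_0_iff) (auto intro!: continuous_intros)
    then have "{c..d} \<subseteq> {x. poly p x = 0}" by auto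
    then have "finite {c..d}"
      using poly_roots_finite[OF assms(2)] finite_subset by blast
    with assms(1) show False by (simp add: infinite_Icc)
  qed
  moreover have "integral {c..d} (\<lambda>x. poly p x * poly p x) \<ge> 0"
    by (intro integral_nonneg integrable_continuous_real continuous_intros) auto
  ultimately show ?thesis by linarith
qed

text \<open>The Riesz representation theorem for polynomials of degree at most \<open>n\<close> with the inner product of
  \<open>L\<^sup>2(c,d)\<close>. The induction is the Gram-Schmidt process: representing the functional
  \<open>s \<mapsto> (monom 1 (n + 1), s)\<close> in degree \<open>n\<close> yields the orthogonal projection of \<open>monom 1 (n + 1)\<close>, hence a
  polynomial \<open>e\<close> of degree \<open>n + 1\<close> orthogonal to all lower degrees, and a multiple of \<open>e\<close> corrects
  the representative found in degree \<open>n\<close>.\<close>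
lemma ex_poly_representing_functional:
  fixes F :: "real poly \<Rightarrow> real"
  assumes cd: "c < d"
    and add: "\<And>p q. F (p + q) = F p + F q" and smult: "\<And>t p. F (smult t p) = t * F p"
  shows "\<exists>P. degree P \<le> n \<and> (\<forall>s. degree s \<le> n \<longrightarrow> integral {c..d} (\<lambda>x. poly P x * poly s x) = F s)"
  using add smult
proof (induction n arbitrary: F)
  case 0
  define P where "P = [:F 1 / (d - c):]"
  have "integral {c..d} (\<lambda>x. poly P x * poly s x) = F s" if "degree s \<le> 0" for s
  proof -
    from that obtain t where s: "s = [:t:]" using degree0_coeffs by blast
    have "F s = t * F 1" using "0.prems"(2)[of t 1] by (simp add: s one_pCons)
    then show ?thesis using cd by (simp add: P_def s content_real)
  qed
  then show ?case by (intro exI[of _ P]) (auto simp: P_def)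
next
  case (Suc n)
  define B where "B p q = integral {c..d} (\<lambda>x. poly p x * poly q x)" for p q :: "real poly"
  have int: "(\<lambda>x. poly p x * poly q x) integrable_on {c..d}" for p q :: "real poly"
    by (intro integrable_continuous_real continuous_intros)
  have B_add: "B p (q + q') = B p q + B p q'" and B_smult: "B p (smult t q) = t * B p q"
    and B_sym: "B p q = B q p" for p q q' t
    using integral_add[OF int int, of p q p q'] integral_mult_right[of "{c..d}" t "\<lambda>x. poly p x * poly q x"]
    by (simp_all add: B_def algebra_simps)
  have B_add': "B (p + p') q = B p q + B p' q" and B_smult': "B (smult t p) q = t * B p q" for p p' q t
    using B_add[of q p p'] B_smult[of q t p] by (simp_all add: B_sym[of q])
  obtain w where w: "degree w \<le> n" "\<And>s. degree s \<le> n \<Longrightarrow> B w s = B (monom 1 (Suc n)) s"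
    using Suc.IH[of "B (monom 1 (Suc n))"] B_add B_smult unfolding B_def by blast
  obtain v where v: "degree v \<le> n" "\<And>s. degree s \<le> n \<Longrightarrow> B v s = F s"
    using Suc.IH[of F] Suc.prems unfolding B_def by blast
  \<comment> \<open>The monic polynomial of degree n + 1 orthogonal to all lower degrees.\<close>
  define e where "e = monom 1 (Suc n) - w"
  have e_orth: "B e s = 0" if "degree s \<le> n" for s
  proof -
    have "B (monom 1 (Suc n)) s = B (e + w) s" by (simp add: e_def)
    also have "\<dots> = B e s + B w s"
      by (rule B_add')
    finally show ?thesis using w(2)[OF that] by simp
  qed
  have "coeff e (Suc n) = 1"
    using w(1) by (simp add: e_def coeff_eq_0)
  then have "e \<noteq> 0" by auto
  then have Be: "B e e > 0"
    unfolding B_def by (rule integral_poly_square_pos[OF cd])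
  have deg_e: "degree e \<le> Suc n"
    unfolding e_def by (rule degree_diff_le) (use w(1) degree_monom_le[of "1::real" "Suc n"] in auto)
  define P where "P = v + smult (F e / B e e) e"
  have "B P s = F s" if "degree s \<le> Suc n" for s
  proof -
    define s0 where "s0 = s - smult (coeff s (Suc n)) e"
    have "degree s0 \<le> n"
    proof (rule degree_le, safe)
      fix i assume "n < i"
      then show "coeff s0 i = 0"
        using that deg_e \<open>coeff e (Suc n) = 1\<close>
        by (cases "i = Suc n") (auto simp: s0_def coeff_eq_0)
    qed
    have s: "s = s0 + smult (coeff s (Suc n)) e" by (simp add: s0_def)
    have "B P e = F e"
      using Be e_orth[OF v(1)] by (simp add: P_def B_add' B_smult' B_sym[of v])
    moreover have "B P s0 = F s0"
      using e_orth[OF \<open>degree s0 \<le> n\<close>] v(2)[OF \<open>degree s0 \<le> n\<close>]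
      by (simp add: P_def B_add' B_smult')
    ultimately show ?thesis
      by (subst (1 2) s) (simp add: B_add B_smult Suc.prems)
  qed
  moreover have "degree P \<le> Suc n"
    unfolding P_def using v(1) deg_e by (intro degree_add_le) (auto intro: order_trans[OF degree_smult_le])
  ultimately show ?case unfolding B_def by blast
qed

section \<open>Finite element functions on a mesh\<close>

text \<open>Adjacent cells share an end point, where both summands contribute. The values at these finitely
  many points are irrelevant, and a sum of indicators is linear and visibly measurable.\<close>
definition piecewise_poly :: "real set set \<Rightarrow> (real set \<Rightarrow> real poly) \<Rightarrow> real \<Rightarrow> real" where
  "piecewise_poly \<T> Q x = (\<Sum>K\<in>\<T>. indicator K x * poly (Q K) x)"

locale mesh =
  fixes a b :: real and \<T> :: "real set set"
  assumes ab: "a < b" and partition: "interval_partition {a<..<b} \<T>"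
begin

abbreviation nodes :: "real set" where "nodes \<equiv> \<Union>K\<in>\<T>. frontier K"

abbreviation pw :: "(real set \<Rightarrow> real poly) \<Rightarrow> real \<Rightarrow> real" where "pw \<equiv> piecewise_poly \<T>"

lemma closure_Ioo: "closure {a<..<b} = {a..b}"
  using ab by simp

lemma division: "\<T> division_of {a..b}"
  using partition by (simp add: interval_partition_def closure_Ioo)

lemma finite_cells: "finite \<T>"
  using division by (rule division_of_finite)

lemma cellE:
  assumes "K \<in> \<T>"
  obtains c d where "K = {c..d}" "c < d" "a \<le> c" "d \<le> b"
proof -
  obtain c d where K: "K = {c..d}"
    using division_ofD(4)[OF division assms] by auto
  moreover have "interior K \<noteq> {}"
    using partition assms by (simp add: interval_partition_def)
  ultimately have "c < d" by (simp add: interior_atLeastAtMost_real)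
  moreover have "{c..d} \<subseteq> {a..b}"
    using division_ofD(2)[OF division assms] K by simp
  ultimately show ?thesis using K that by auto
qed

lemma finite_frontier_cell:
  assumes "K \<in> \<T>"
  shows "finite (frontier K)"
proof -
  obtain c d where "K = {c..d}" using cellE[OF assms] .
  then have "frontier K \<subseteq> {c, d}" by (auto simp: frontier_def interior_atLeastAtMost_real)
  then show ?thesis by (rule finite_subset) simp
qed

lemma finite_nodes: "finite nodes"
  using finite_cells finite_frontier_cell by blast

lemma cell_interior_cases:
  assumes "x \<in> {a..b} - nodes"
  obtains K where "K \<in> \<T>" "x \<in> interior K"
proof -
  obtain K where K: "K \<in> \<T>" "x \<in> K"
    using assms division_ofD(6)[OF division] by blast
  then have "x \<in> interior K"
    using assms closure_subset[of K] by (auto simp: frontier_def)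
  with K(1) show ?thesis by (rule that)
qed

lemma pw_eq_poly:
  assumes K: "K \<in> \<T>" "x \<in> interior K" and x: "x \<notin> nodes"
  shows "pw Q x = poly (Q K) x"
proof -
  have "indicator L x * poly (Q L) x = 0" if "L \<in> \<T> - {K}" for L
  proof -
    have "x \<notin> interior L"
      using division_ofD(5)[OF division, of K L] K that by auto
    then have "x \<notin> L"
      using x that closure_subset[of L] by (auto simp: frontier_def)
    then show ?thesis by simp
  qed
  moreover have "x \<in> K" using K(2) interior_subset by blast
  moreover have "(\<Sum>L\<in>\<T> - {K}. indicator L x * poly (Q L) x) = 0"
    using calculation(1) by (intro sum.neutral) blast
  ultimately show ?thesis
    unfolding piecewise_poly_def sum.remove[OF finite_cells K(1)] by simp
qed

lemma integrable_cell:
  fixes h :: "real \<Rightarrow> real"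
  assumes "K \<in> \<T>" "continuous_on K h"
  shows "integrable (lebesgue_on {a..b}) (\<lambda>x. indicator K x * h x)"
proof -
  obtain c d where K: "K = {c..d}" "a \<le> c" "d \<le> b" using cellE[OF assms(1)] .
  have "integrable (lebesgue_on K) h"
    using assms(2) unfolding K by (rule continuous_imp_integrable_real)
  moreover have "(\<lambda>x. indicator {a..b} x *\<^sub>R (indicator K x * h x)) = (\<lambda>x. indicator K x *\<^sub>R h x)"
    using K by (auto simp: indicator_def)
  ultimately have "integrable lebesgue (\<lambda>x. indicator {a..b} x *\<^sub>R (indicator K x * h x))"
    using K by (simp only:) (simp add: integrable_restrict_space)
  then show ?thesis by (subst integrable_restrict_space) simp_all
qed

lemma integrable_pw: "integrable (lebesgue_on {a..b}) (pw Q)"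
  unfolding piecewise_poly_def[abs_def]
  by (intro Bochner_Integration.integrable_sum integrable_cell continuous_intros)

lemma integrable_pw_mult: "integrable (lebesgue_on {a..b}) (\<lambda>x. pw Q x * pw R x)"
proof -
  have "integrable (lebesgue_on {a..b}) (\<lambda>x. indicator L x *\<^sub>R (indicator K x * (poly (Q K) x * poly (R L) x)))"
    if "K \<in> \<T>" "L \<in> \<T>" for K L
  proof (rule integrable_mult_indicator)
    show "L \<in> sets (lebesgue_on {a..b})"
      using that by (auto elim!: cellE simp: sets_restrict_space_iff)
  qed (intro integrable_cell that continuous_intros)
  then have "integrable (lebesgue_on {a..b})
      (\<lambda>x. \<Sum>K\<in>\<T>. \<Sum>L\<in>\<T>. indicator L x *\<^sub>R (indicator K x * (poly (Q K) x * poly (R L) x)))"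
    by (intro Bochner_Integration.integrable_sum)
  then show ?thesis
    by (simp add: piecewise_poly_def sum_product mult_ac)
qed

lemma integral_eq_sum_cells:
  assumes h: "h integrable_on {a..b}"
    and eq: "\<And>K x. K \<in> \<T> \<Longrightarrow> x \<in> interior K \<Longrightarrow> x \<notin> nodes \<Longrightarrow> h x = poly (S K) x"
  shows "integral {a..b} h = (\<Sum>K\<in>\<T>. integral K (poly (S K)))"
proof -
  have "integral {a..b} h = (\<Sum>K\<in>\<T>. integral K h)"
    by (rule integral_combine_division_topdown[OF h division])
  also have "\<dots> = (\<Sum>K\<in>\<T>. integral K (poly (S K)))"
  proof (rule sum.cong[OF refl])
    fix K assume K: "K \<in> \<T>"
    show "integral K h = integral K (poly (S K))"
    proof (rule integral_spike)
      show "negligible nodes" using finite_nodes by (rule negligible_finite)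
      fix x assume "x \<in> K - nodes"
      then have "x \<in> interior K" "x \<notin> nodes"
        using K closure_subset[of K] by (auto simp: frontier_def)
      then show "poly (S K) x = h x" using eq[OF K] by simp
    qed
  qed
  finally show ?thesis .
qed

lemma has_derivative_pw:
  assumes w: "\<And>K x. K \<in> \<T> \<Longrightarrow> x \<in> K \<Longrightarrow> w x = poly (P K) x"
    and x: "x \<in> {a<..<b} - nodes"
  shows "(w has_real_derivative pw (\<lambda>K. pderiv (P K)) x) (at x)"
proof -
  obtain K where K: "K \<in> \<T>" "x \<in> interior K"
    by (rule cell_interior_cases[of x]) (use x in auto)
  have "(poly (P K) has_real_derivative pw (\<lambda>K. pderiv (P K)) x) (at x)"
    using pw_eq_poly[OF K] x by (simp add: poly_DERIV)
  then show ?thesis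
    by (rule has_field_derivative_transform_within_open[where S = "interior K"])
      (use K w[OF K(1)] interior_subset[of K] in auto)
qed

lemma L2_inner_weak_deriv_eq_sum_cells:
  assumes v: "continuous_on {a..b} v" "\<And>K x. K \<in> \<T> \<Longrightarrow> x \<in> K \<Longrightarrow> v x = poly (P K) x"
    and w: "continuous_on {a..b} w" "\<And>K x. K \<in> \<T> \<Longrightarrow> x \<in> K \<Longrightarrow> w x = poly (R K) x"
  shows "L2_inner {a<..<b} (weak_deriv {a<..<b} v) (weak_deriv {a<..<b} w) =
    (\<Sum>K\<in>\<T>. integral K (\<lambda>x. poly (pderiv (P K)) x * poly (pderiv (R K)) x))"
proof -
  let ?p = "pw (\<lambda>K. pderiv (P K))" and ?r = "pw (\<lambda>K. pderiv (R K))"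
  have "L2_inner {a<..<b} (weak_deriv {a<..<b} v) (weak_deriv {a<..<b} w)
      = integral {a..b} (\<lambda>x. ?p x * ?r x)"
    using ab finite_nodes v w
    by (intro L2_inner_Ioo_cong_negligible weak_deriv_eq_classical[where S = nodes]
        integrable_pw integrable_pw_mult has_derivative_pw) auto
  also have "\<dots> = (\<Sum>K\<in>\<T>. integral K (poly (pderiv (P K) * pderiv (R K))))"
    using integrable_pw_mult[THEN integrable_on_lebesgue_on]
    by (intro integral_eq_sum_cells) (auto simp: pw_eq_poly)
  finally show ?thesis by (simp add: poly_mult[abs_def])
qed

lemma fe_spaceE:
  assumes "w \<in> fe_space {a<..<b} \<T> r"
  obtains P where "continuous_on {a..b} w" "w a = 0" "w b = 0"
    "\<And>K. K \<in> \<T> \<Longrightarrow> degree (P K) \<le> r - 1" "\<And>K x. K \<in> \<T> \<Longrightarrow> x \<in> K \<Longrightarrow> w x = poly (P K) x"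
proof -
  have "\<forall>K\<in>\<T>. \<exists>P. degree P \<le> r - 1 \<and> (\<forall>x\<in>K. w x = poly P x)"
    using assms by (simp add: fe_space_def)
  then obtain P where "\<forall>K\<in>\<T>. degree (P K) \<le> r - 1 \<and> (\<forall>x\<in>K. w x = poly (P K) x)"
    by (rule bchoice[THEN exE])
  moreover have "w a = 0" "w b = 0" "continuous_on {a..b} w"
    using assms ab by (auto simp: fe_space_def frontier_def closure_Ioo)
  ultimately show ?thesis using that by blast
qed

text \<open>Every piecewise polynomial of degree at most \<open>r - 2\<close> with mean zero is the derivative of a finite
  element function, namely of its indefinite integral: continuity across the nodes is automatic,
  and the zero mean provides the boundary value at \<open>b\<close>.\<close>
lemma ex_fe_function_with_deriv:
  assumes r: "r \<ge> 2" and deg: "\<And>K. K \<in> \<T> \<Longrightarrow> degree (Q K) \<le> r - 2"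
    and mean0: "(\<Sum>K\<in>\<T>. integral K (poly (Q K))) = 0"
  obtains v P where "v \<in> fe_space {a<..<b} \<T> r" "continuous_on {a..b} v"
    "\<And>K x. K \<in> \<T> \<Longrightarrow> x \<in> K \<Longrightarrow> v x = poly (P K) x" "\<And>K. K \<in> \<T> \<Longrightarrow> pderiv (P K) = Q K"
proof -
  have int: "pw Q integrable_on {a..b}"
    using integrable_pw by (rule integrable_on_lebesgue_on) simp
  define v where "v x = integral {a..x} (pw Q)" for x
  have cont: "continuous_on {a..b} v"
    unfolding v_def using int by (rule indefinite_integral_continuous_1)
  have "integral {a..b} (pw Q) = (\<Sum>K\<in>\<T>. integral K (poly (Q K)))"
    by (intro integral_eq_sum_cells int) (simp add: pw_eq_poly)
  then have v_ends: "v a = 0" "v b = 0" using mean0 by (simp_all add: v_def)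
  have piece: "\<exists>P. pderiv P = Q K \<and> degree P \<le> r - 1 \<and> (\<forall>x\<in>K. v x = poly P x)" if K: "K \<in> \<T>" for K
  proof -
    obtain c d where cd: "K = {c..d}" "c < d" "a \<le> c" "d \<le> b" using cellE[OF K] .
    obtain A where A: "pderiv A = Q K" "degree A \<le> Suc (degree (Q K))"
      using ex_poly_antiderivative by blast
    define P where "P = A + [:v c - poly A c:]"
    have "v x = poly P x" if x: "x \<in> K" for x
    proof -
      have "v x = v c + integral {c..x} (pw Q)"
        unfolding v_def using cd x
        by (intro Henstock_Kurzweil_Integration.integral_combine[symmetric] integrable_on_subinterval[OF int]) auto
      also have "integral {c..x} (pw Q) = integral {c..x} (poly (Q K))"
      proof (rule integral_spike)
        show "negligible nodes" using finite_nodes by (rule negligible_finite)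
        fix y assume "y \<in> {c..x} - nodes"
        then show "poly (Q K) y = pw Q y"
          using x cd K closure_subset[of K] by (subst pw_eq_poly[OF K]) (auto simp: frontier_def)
      qed
      also have "(poly (Q K) has_integral (poly A x - poly A c)) {c..x}"
      proof (rule fundamental_theorem_of_calculus)
        show "c \<le> x" using x cd by simp
        show "(poly A has_vector_derivative poly (Q K) y) (at y within {c..x})" for y
          unfolding has_real_derivative_iff_has_vector_derivative[symmetric] A(1)[symmetric]
          by (rule has_field_derivative_at_within[OF poly_DERIV])
      qed
      then have "integral {c..x} (poly (Q K)) = poly A x - poly A c" by (rule integral_unique)
      finally show ?thesis by (simp add: P_def)
    qed
    moreover have "degree P \<le> r - 1"
      unfolding P_def using A(2) deg[OF K] r by (intro degree_add_le) auto
    moreover have "pderiv P = Q K"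
      by (simp add: P_def A pderiv_add pderiv_pCons)
    ultimately show ?thesis by blast
  qed
  then obtain P where P: "\<And>K. K \<in> \<T> \<Longrightarrow> pderiv (P K) = Q K"
    "\<And>K x. K \<in> \<T> \<Longrightarrow> x \<in> K \<Longrightarrow> v x = poly (P K) x"
    by metis
  have "v \<in> fe_space {a<..<b} \<T> r"
    unfolding fe_space_def using cont v_ends piece ab by (auto simp: frontier_def closure_Ioo) 
  then show ?thesis using cont P that by blast
qed

text \<open>The function with value 0 at \<open>a\<close> whose derivative is \<open>s\<close> on the cell \<open>K\<close> and 0 elsewhere. It is
  constant beyond \<open>K\<close>, so it lies outside the finite element space in general, but it is the piece
  that the derivative on \<open>K\<close> contributes to a finite element function.\<close>
definition cell_ramp :: "real set \<Rightarrow> real poly \<Rightarrow> real \<Rightarrow> real" where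
  "cell_ramp K s x = integral {a..x} (\<lambda>t. indicator K t * poly s t)"

lemma integrable_on_cell:
  assumes "K \<in> \<T>" "x \<le> b"
  shows "(\<lambda>t. indicator K t * poly s t) integrable_on {a..x}"
proof -
  have "(\<lambda>t. indicator K t * poly s t) integrable_on {a..b}"
    by (intro integrable_on_lebesgue_on[OF integrable_cell] assms continuous_intros) simp
  then show ?thesis by (rule integrable_on_subinterval) (use assms in auto)
qed

lemma cell_ramp_add: "K \<in> \<T> \<Longrightarrow> x \<le> b \<Longrightarrow> cell_ramp K (s + s') x = cell_ramp K s x + cell_ramp K s' x"
  unfolding cell_ramp_def
  by (subst integral_add[symmetric]) (auto simp: algebra_simps intro!: integrable_on_cell)

lemma cell_ramp_smult: "cell_ramp K (smult t s) x = t * cell_ramp K s x"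
  unfolding cell_ramp_def by (subst integral_mult_right[symmetric]) (simp add: mult_ac)

lemma fe_function_eq_sum_cell_ramps:
  assumes w: "continuous_on {a..b} w" "w a = 0" "\<And>K x. K \<in> \<T> \<Longrightarrow> x \<in> K \<Longrightarrow> w x = poly (R K) x"
    and x: "x \<in> {a..b}"
  shows "w x = (\<Sum>K\<in>\<T>. cell_ramp K (pderiv (R K)) x)"
proof -
  have "(pw (\<lambda>K. pderiv (R K)) has_integral (w x - w a)) {a..x}"
  proof (rule fundamental_theorem_of_calculus_interior_strong[OF finite_nodes])
    show "(w has_vector_derivative pw (\<lambda>K. pderiv (R K)) y) (at y)" if "y \<in> {a<..<x} - nodes" for y
      unfolding has_real_derivative_iff_has_vector_derivative[symmetric]
      using that x by (intro has_derivative_pw w(3)) auto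
  qed (use x continuous_on_subset[OF w(1), of "{a..x}"] in auto)
  then have "w x = integral {a..x} (pw (\<lambda>K. pderiv (R K)))"
    using w(2) by (simp add: integral_unique)
  also have "\<dots> = (\<Sum>K\<in>\<T>. cell_ramp K (pderiv (R K)) x)"
    unfolding piecewise_poly_def[abs_def] cell_ramp_def
    using x by (intro integral_sum finite_cells integrable_on_cell) auto
  finally show ?thesis .
qed

lemma integrable_mult_continuous:
  fixes f g :: "real \<Rightarrow> real"
  assumes f: "integrable (lebesgue_on {a<..<b}) f" and g: "continuous_on {a..b} g"
  shows "integrable (lebesgue_on {a<..<b}) (\<lambda>x. f x * g x)"
proof -
  have "(\<lambda>x. g x * f x) absolutely_integrable_on {a<..<b}"
  proof (rule absolutely_integrable_bounded_measurable_product_real)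
    show "g \<in> borel_measurable (lebesgue_on {a<..<b})"
      by (intro continuous_imp_measurable_on_sets_lebesgue continuous_on_subset[OF g]) auto
    show "bounded (g ` {a<..<b})"
      by (rule bounded_subset[OF compact_imp_bounded[OF compact_continuous_image[OF g]]]) auto
    show "f absolutely_integrable_on {a<..<b}"
      using f by (simp add: set_integrable_def integrable_restrict_space)
  qed auto
  then show ?thesis
    by (simp add: set_integrable_def integrable_restrict_space mult.commute)
qed

text \<open>Through the ramps, the functional \<open>\<psi> \<mapsto> - (f, \<psi>)\<close> becomes a sum over the cells \<open>K\<close> of linear
  functionals \<open>F K\<close> of the polynomial \<open>\<psi>'\<close> on \<open>K\<close>. On each cell \<open>F K\<close> has a representing polynomial
  \<open>G K\<close>, so the piecewise polynomial \<open>G\<close> has the required inner products with all \<open>\<psi>'\<close>. Its mean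
  \<open>m\<close> need not vanish, but \<open>\<psi>'\<close> is orthogonal to constants because \<open>\<psi> a = \<psi> b\<close>; so \<open>G - m\<close> serves as
  well, and it is the derivative of a finite element function. Constants are available as pieces
  since \<open>r \<ge> 2\<close>.\<close>
theorem ex_discrete_Poisson_solution:
  assumes r: "r \<ge> 2" and f: "integrable (lebesgue_on {a<..<b}) f"
  shows "\<exists>v\<in>fe_space {a<..<b} \<T> r. \<forall>\<psi>\<in>fe_space {a<..<b} \<T> r.
    L2_inner {a<..<b} (weak_deriv {a<..<b} v) (weak_deriv {a<..<b} \<psi>) = - L2_inner {a<..<b} f \<psi>"
proof -
  define F where "F K s = - (LINT x|lebesgue_on {a<..<b}. f x * cell_ramp K s x)" for K s
  have int_ramp: "integrable (lebesgue_on {a<..<b}) (\<lambda>x. f x * cell_ramp K s x)" if "K \<in> \<T>" for K s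
    unfolding cell_ramp_def
    by (intro integrable_mult_continuous f indefinite_integral_continuous_1 integrable_on_cell that) simp
  have F_add: "F K (s + s') = F K s + F K s'" if K: "K \<in> \<T>" for K s s'
  proof -
    have "(LINT x|lebesgue_on {a<..<b}. f x * cell_ramp K (s + s') x)
      = (LINT x|lebesgue_on {a<..<b}. f x * cell_ramp K s x + f x * cell_ramp K s' x)"
      by (intro Bochner_Integration.integral_cong) (auto simp: cell_ramp_add K algebra_simps)
    then show ?thesis
      using int_ramp[OF K] by (simp add: F_def)
  qed
  have F_smult: "F K (smult t s) = t * F K s" for K t s
    by (simp add: F_def cell_ramp_smult mult.left_commute)
  have "\<exists>P. degree P \<le> r - 2 \<and> (\<forall>s. degree s \<le> r - 2 \<longrightarrow> integral K (\<lambda>x. poly P x * poly s x) = F K s)"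
    if K: "K \<in> \<T>" for K
    using cellE[OF K] ex_poly_representing_functional[of _ _ "F K", OF _ F_add[OF K] F_smult] by metis
  then obtain G where G: "\<And>K. K \<in> \<T> \<Longrightarrow> degree (G K) \<le> r - 2"
    "\<And>K s. K \<in> \<T> \<Longrightarrow> degree s \<le> r - 2 \<Longrightarrow> integral K (\<lambda>x. poly (G K) x * poly s x) = F K s"
    by metis
  define m where "m = (\<Sum>K\<in>\<T>. integral K (poly (G K))) / (b - a)"
  have int_cell: "poly p integrable_on K" if "K \<in> \<T>" for K p
    using that by (auto elim!: cellE intro!: integrable_continuous_real continuous_intros)
  have sum1: "(\<Sum>K\<in>\<T>. integral K (\<lambda>x. 1)) = b - a"
    using integral_combine_division_topdown[OF _ division, of "\<lambda>x. 1 :: real"] ab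
    by (simp add: integrable_const_ivl)
  have "(\<Sum>K\<in>\<T>. integral K (poly (G K - [:m:]))) = (\<Sum>K\<in>\<T>. integral K (poly (G K)) - m * integral K (\<lambda>x. 1))"
  proof (rule sum.cong[OF refl])
    fix K assume K: "K \<in> \<T>"
    have "integral K (\<lambda>x. poly (G K) x - poly [:m:] x) = integral K (poly (G K)) - integral K (poly [:m:])"
      using int_cell[OF K] by (intro integral_diff)
    then show "integral K (poly (G K - [:m:])) = integral K (poly (G K)) - m * integral K (\<lambda>x. 1)"
      using integral_mult_right[of K m "\<lambda>x. 1"] by (simp add: poly_diff[abs_def] poly_pCons[abs_def])
  qed
  also have "\<dots> = 0"
    unfolding sum_subtractf sum_distrib_left[symmetric] sum1 using ab by (simp add: m_def)
  finally have mean0: "(\<Sum>K\<in>\<T>. integral K (poly (G K - [:m:]))) = 0" .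
  have "degree (G K - [:m:]) \<le> r - 2" if "K \<in> \<T>" for K
    using G(1)[OF that] by (intro degree_diff_le) auto
  from ex_fe_function_with_deriv[OF r this mean0] obtain v P where v: "v \<in> fe_space {a<..<b} \<T> r"
    "continuous_on {a..b} v" "\<And>K x. K \<in> \<T> \<Longrightarrow> x \<in> K \<Longrightarrow> v x = poly (P K) x"
    "\<And>K. K \<in> \<T> \<Longrightarrow> pderiv (P K) = G K - [:m:]" by blast
  have "L2_inner {a<..<b} (weak_deriv {a<..<b} v) (weak_deriv {a<..<b} \<psi>) = - L2_inner {a<..<b} f \<psi>"
    if mem: "\<psi> \<in> fe_space {a<..<b} \<T> r" for \<psi>
  proof -
    obtain R where \<psi>: "continuous_on {a..b} \<psi>" "\<psi> a = 0" "\<psi> b = 0"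
      "\<And>K. K \<in> \<T> \<Longrightarrow> degree (R K) \<le> r - 1" "\<And>K x. K \<in> \<T> \<Longrightarrow> x \<in> K \<Longrightarrow> \<psi> x = poly (R K) x"
      using fe_spaceE[OF mem] by metis
    have ramps: "\<psi> x = (\<Sum>K\<in>\<T>. cell_ramp K (pderiv (R K)) x)" if "x \<in> {a..b}" for x
      using \<psi> that by (intro fe_function_eq_sum_cell_ramps) auto
    have ramp_b: "cell_ramp K s b = integral K (poly s)" if "K \<in> \<T>" for K s
    proof -
      have "cell_ramp K s b = integral {a..b} (\<lambda>t. if t \<in> K then poly s t else 0)"
        unfolding cell_ramp_def by (intro integral_cong) (simp add: indicator_def)
      also have "\<dots> = integral (K \<inter> {a..b}) (poly s)" by (rule integral_restrict_Int)
      also have "K \<inter> {a..b} = K" using division_ofD(2)[OF division that] by blast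
      finally show ?thesis .
    qed
    have "L2_inner {a<..<b} (weak_deriv {a<..<b} v) (weak_deriv {a<..<b} \<psi>)
        = (\<Sum>K\<in>\<T>. integral K (\<lambda>x. poly (pderiv (P K)) x * poly (pderiv (R K)) x))"
      by (rule L2_inner_weak_deriv_eq_sum_cells[OF v(2,3) \<psi>(1,5)])
    also have "\<dots> = (\<Sum>K\<in>\<T>. F K (pderiv (R K)) - m * cell_ramp K (pderiv (R K)) b)"
    proof (rule sum.cong[OF refl])
      fix K assume K: "K \<in> \<T>"
      let ?s = "pderiv (R K)"
      have "integral K (\<lambda>x. poly (pderiv (P K)) x * poly ?s x)
          = integral K (\<lambda>x. poly (G K * ?s) x - m * poly ?s x)"
        by (simp add: v(4)[OF K] algebra_simps)
      also have "\<dots> = integral K (poly (G K * ?s)) - integral K (\<lambda>x. m * poly ?s x)"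
        using int_cell[OF K, of "smult m ?s"] by (intro integral_diff int_cell K) (simp add: poly_smult[abs_def])
      also have "integral K (poly (G K * ?s)) = F K ?s"
        using G(2)[OF K, of ?s] \<psi>(4)[OF K] by (simp add: degree_pderiv poly_mult[abs_def])
      finally show "integral K (\<lambda>x. poly (pderiv (P K)) x * poly ?s x) = F K ?s - m * cell_ramp K ?s b"
        by (simp add: ramp_b K)
    qed
    also have "\<dots> = (\<Sum>K\<in>\<T>. F K (pderiv (R K))) - m * \<psi> b"
      using ramps[of b] ab by (simp add: sum_subtractf sum_distrib_left)
    also have "\<dots> = - (\<Sum>K\<in>\<T>. LINT x|lebesgue_on {a<..<b}. f x * cell_ramp K (pderiv (R K)) x)"
      by (simp add: \<psi>(3) F_def sum_negf)
    also have "\<dots> = - (LINT x|lebesgue_on {a<..<b}. (\<Sum>K\<in>\<T>. f x * cell_ramp K (pderiv (R K)) x))"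
      by (subst Bochner_Integration.integral_sum) (auto intro: int_ramp)
    also have "\<dots> = - L2_inner {a<..<b} f \<psi>"
      unfolding L2_inner_def
      by (intro arg_cong[of _ _ uminus] Bochner_Integration.integral_cong)
        (auto simp: ramps sum_distrib_left)
    finally show ?thesis .
  qed
  with v(1) show ?thesis by blast
qed

end

section \<open>The coupled system\<close>

lemma L2_fun_imp_integrable:
  assumes "L2_fun {a<..<b} f"
  shows "integrable (lebesgue_on {a<..<b}) f"
proof (rule Bochner_Integration.integrable_bound)
  have "integrable (lebesgue_on {a<..<b}) (\<lambda>x. 1 :: real)"
    by (rule integrable_lebesgue_on_subset[of "{a..b}"]) (auto intro: continuous_imp_integrable_real)
  then show "integrable (lebesgue_on {a<..<b}) (\<lambda>x. 1 + (f x)\<^sup>2)"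
    using assms by (simp add: L2_fun_def)
  show "f \<in> borel_measurable (lebesgue_on {a<..<b})"
    using assms by (simp add: L2_fun_def)
  have "\<bar>y\<bar> \<le> 1 + y\<^sup>2" for y :: real
    using zero_le_power2[of "\<bar>y\<bar> - 1"] zero_le_power2[of y] unfolding power2_diff power2_abs by simp
  then show "AE x in lebesgue_on {a<..<b}. norm (f x) \<le> norm (1 + (f x)\<^sup>2)"
    by (intro AE_I2) simp
qed

text \<open>Only the zeros of \<open>v\<close> are critical: there the bound \<open>\<bar>y\<bar> powr (q - 1)\<close> tends to 0 as \<open>q > 1\<close>,
  although the factor \<open>\<bar>y\<bar> powr (q - 2)\<close> blows up for \<open>q < 2\<close>.\<close>
lemma continuous_on_signed_powr:
  fixes v :: "real \<Rightarrow> real"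
  assumes q: "q > 1" and v: "continuous_on S v"
  shows "continuous_on S (\<lambda>x. \<bar>v x\<bar> powr (q - 2) * v x)"
proof -
  have "isCont (\<lambda>y. \<bar>y\<bar> powr (q - 2) * y) y" for y :: real
  proof (cases "y = 0")
    case True
    have bound: "norm (\<bar>y\<bar> powr (q - 2) * y) \<le> \<bar>y\<bar> powr (q - 1)" for y :: real
    proof -
      have "norm (\<bar>y\<bar> powr (q - 2) * y) = \<bar>y\<bar> * \<bar>y\<bar> powr (q - 2)"
        by (simp add: abs_mult)
      also have "\<dots> = \<bar>y\<bar> powr (1 + (q - 2))" by (rule powr_mult_base) simp
      finally show ?thesis by simp
    qed
    have "((\<lambda>y. \<bar>y\<bar> powr (q - 1)) \<longlongrightarrow> \<bar>0::real\<bar> powr (q - 1)) (at 0)"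
      by (rule tendsto_powr'[OF tendsto_rabs[OF tendsto_ident_at] tendsto_const]) (use q in simp)
    then have "((\<lambda>y. \<bar>y\<bar> powr (q - 1)) \<longlongrightarrow> 0) (at 0)" by simp
    then have "((\<lambda>y. \<bar>y\<bar> powr (q - 2) * y) \<longlongrightarrow> 0) (at 0)"
      by (rule Lim_null_comparison[OF always_eventually[OF allI[OF bound]]])
    with True show ?thesis by (simp add: isCont_def)
  qed (intro continuous_intros, auto)
  then have "continuous_on UNIV (\<lambda>y::real. \<bar>y\<bar> powr (q - 2) * y)"
    by (simp add: continuous_on_eq_continuous_at)
  from continuous_on_compose2[OF this v] show ?thesis by simp
qed

theorem theorem4p1:
  fixes a b p q :: real and \<Omega> :: "real set" and \<T> :: "real set set" and r :: nat
    and f :: "real \<Rightarrow> real"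
  assumes "a < b" and "\<Omega> = {a<..<b}"
    and "1 < p" and "q = p / (p - 1)"
    and "r \<ge> 2"
    and "interval_partition \<Omega> \<T>"
    and "L2_fun \<Omega> f"
  shows "\<exists>u\<in>fe_space \<Omega> \<T> r. \<exists>v\<in>fe_space \<Omega> \<T> r.
    (\<forall>\<psi>\<in>fe_space \<Omega> \<T> r.
       L2_inner \<Omega> (weak_deriv \<Omega> v) (weak_deriv \<Omega> \<psi>) = - L2_inner \<Omega> f \<psi>) \<and>
    (\<forall>\<eta>\<in>fe_space \<Omega> \<T> r.
       L2_inner \<Omega> (weak_deriv \<Omega> u) (weak_deriv \<Omega> \<eta>)
         = - L2_inner \<Omega> (\<lambda>x. \<bar>v x\<bar> powr (q - 2) * v x) \<eta>)"
proof -
  interpret mesh a b \<T>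
    using assms by unfold_locales simp_all
  have q: "q > 1" using assms(3,4) by (simp add: less_divide_eq)
  have "integrable (lebesgue_on {a<..<b}) f"
    using assms(2,7) L2_fun_imp_integrable by simp
  from ex_discrete_Poisson_solution[OF assms(5) this] obtain v where
    v: "v \<in> fe_space \<Omega> \<T> r" "\<forall>\<psi>\<in>fe_space \<Omega> \<T> r.
       L2_inner \<Omega> (weak_deriv \<Omega> v) (weak_deriv \<Omega> \<psi>) = - L2_inner \<Omega> f \<psi>"
    unfolding assms(2) by blast
  have "continuous_on {a..b} v"
    using v(1) unfolding assms(2) by (rule fe_spaceE)
  then have "integrable (lebesgue_on {a..b}) (\<lambda>x. \<bar>v x\<bar> powr (q - 2) * v x)"
    by (intro continuous_imp_integrable_real continuous_on_signed_powr q)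
  then have "integrable (lebesgue_on {a<..<b}) (\<lambda>x. \<bar>v x\<bar> powr (q - 2) * v x)"
    by (rule integrable_lebesgue_on_subset) auto
  from ex_discrete_Poisson_solution[OF assms(5) this] v show ?thesis
    unfolding assms(2) by blast
qed

end
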